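(* Let $(\mathfrak g,\langle\cdot,\cdot\rangle)$ be a $5$-dimensional metric Lie algebra whose center $\mathfrak z$ satisfies $\dim\mathfrak z>1$. Then any strict CKY $2$-form $\omega$ on $(\mathfrak g,\langle\cdot,\cdot\rangle)$ is not closed, i.e. $d\omega\neq0$.
   Context: A metric Lie algebra $(\mathfrak g,\langle\cdot,\cdot\rangle)$ is a finite-dimensional real Lie algebra with an inner product; $\nabla$ is given by $2\langle\nabla_xy,z\rangle=\langle[x,y],z\rangle-\langle[y,z],x\rangle+\langle[z,x],y\rangle$, and $(\nabla_xT)y=\nabla_x(Ty)-T(\nabla_xy)$. A $2$-form $\omega\in\Lambda^2\mathfrak g^*$ corresponds to the skew-symmetric endomorphism $T$ with $\omega(x,y)=\langle Tx,y\rangle$. $\omega$ is CKY (conformal Killing-Yano) if there is $\theta\in\mathfrak g^*$ with $$\langle(\nabla_xT)y,z\rangle+\langle(\nabla_yT)x,z\rangle=2\langle x,y\rangle\theta(z)-\langle y,z\rangle\theta(x)-\langle x,z\rangle\theta(y)\quad\text{for all }x,y,z\in\mathfrak g,$$ and strict CKY if moreover $\theta\neq0$. The exterior derivative is $d\omega(x,y,z)=-\omega([x,y],z)-\omega([y,z],x)-\omega([z,x],y)$. *)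

theory Defs
  imports "HOL-Analysis.Analysis"
begin

text \<open>
  The underlying metric vector space of a metric Lie algebra is a type of class
  \<open>euclidean_space\<close>, whose inner product is \<open>(\<bullet>)\<close>; the bracket is an explicit parameter.
\<close>

definition lie_bracket :: "('a::euclidean_space \<Rightarrow> 'a \<Rightarrow> 'a) \<Rightarrow> bool" where
  "lie_bracket br \<longleftrightarrow>
     bilinear br \<and> (\<forall>x. br x x = 0) \<and>
     (\<forall>x y z. br x (br y z) + br y (br z x) + br z (br x y) = 0)"

definition lie_center :: "('a::euclidean_space \<Rightarrow> 'a \<Rightarrow> 'a) \<Rightarrow> 'a set" where
  "lie_center br = {x. \<forall>y. br x y = 0}"

definition levi_civita :: "('a::euclidean_space \<Rightarrow> 'a \<Rightarrow> 'a) \<Rightarrow> 'a \<Rightarrow> 'a \<Rightarrow> 'a" where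
  "levi_civita br x y =
     (THE v. \<forall>z. 2 * (v \<bullet> z) = br x y \<bullet> z - br y z \<bullet> x + br z x \<bullet> y)"

definition cov_deriv ::
  "('a::euclidean_space \<Rightarrow> 'a \<Rightarrow> 'a) \<Rightarrow> 'a \<Rightarrow> ('a \<Rightarrow> 'a) \<Rightarrow> 'a \<Rightarrow> 'a" where
  "cov_deriv br x T y = levi_civita br x (T y) - T (levi_civita br x y)"

definition two_form :: "('a::euclidean_space \<Rightarrow> 'a \<Rightarrow> real) \<Rightarrow> bool" where
  "two_form \<omega> \<longleftrightarrow> bilinear \<omega> \<and> (\<forall>x. \<omega> x x = 0)"

definition form_endo :: "('a::euclidean_space \<Rightarrow> 'a \<Rightarrow> real) \<Rightarrow> 'a \<Rightarrow> 'a" where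
  "form_endo \<omega> = (THE T. linear T \<and> (\<forall>x y. \<omega> x y = T x \<bullet> y))"

definition cky_equation ::
  "('a::euclidean_space \<Rightarrow> 'a \<Rightarrow> 'a) \<Rightarrow> ('a \<Rightarrow> 'a \<Rightarrow> real) \<Rightarrow> ('a \<Rightarrow> real) \<Rightarrow> bool" where
  "cky_equation br \<omega> \<theta> \<longleftrightarrow>
     (\<forall>x y z. cov_deriv br x (form_endo \<omega>) y \<bullet> z + cov_deriv br y (form_endo \<omega>) x \<bullet> z
            = 2 * (x \<bullet> y) * \<theta> z - (y \<bullet> z) * \<theta> x - (x \<bullet> z) * \<theta> y)"

definition strict_cky :: "('a::euclidean_space \<Rightarrow> 'a \<Rightarrow> 'a) \<Rightarrow> ('a \<Rightarrow> 'a \<Rightarrow> real) \<Rightarrow> bool" where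
  "strict_cky br \<omega> \<longleftrightarrow>
     two_form \<omega> \<and> (\<exists>\<theta>. linear \<theta> \<and> \<theta> \<noteq> (\<lambda>_. 0) \<and> cky_equation br \<omega> \<theta>)"

definition ext_deriv ::
  "('a::euclidean_space \<Rightarrow> 'a \<Rightarrow> 'a) \<Rightarrow> ('a \<Rightarrow> 'a \<Rightarrow> real) \<Rightarrow> 'a \<Rightarrow> 'a \<Rightarrow> 'a \<Rightarrow> real" where
  "ext_deriv br \<omega> x y z = - \<omega> (br x y) z - \<omega> (br y z) x - \<omega> (br z x) y"

text \<open>Both definite descriptions above are well defined.\<close>

lemma inner_represents_linear:
  fixes f :: "'a::euclidean_space \<Rightarrow> real"
  assumes "linear f"
  shows "(\<Sum>b\<in>Basis. f b *\<^sub>R b) \<bullet> z = f z"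
proof -
  have "f z = f (\<Sum>b\<in>Basis. (z \<bullet> b) *\<^sub>R b)"
    by (simp add: euclidean_representation)
  also have "\<dots> = (\<Sum>b\<in>Basis. (z \<bullet> b) * f b)"
    using assms by (simp add: linear_sum linear_scale)
  finally show ?thesis
    by (simp add: inner_sum_left inner_commute[of z] mult.commute)
qed

lemma levi_civita_koszul:
  assumes "lie_bracket br"
  shows "2 * (levi_civita br x y \<bullet> z) = br x y \<bullet> z - br y z \<bullet> x + br z x \<bullet> y"
proof -
  define f where "f z = br x y \<bullet> z - br y z \<bullet> x + br z x \<bullet> y" for z
  have bil: "bilinear br"
    using assms by (simp add: lie_bracket_def)
  have "linear f"
    by (rule linearI)
       (simp_all add: f_def bilinear_ladd[OF bil] bilinear_radd[OF bil] bilinear_lmul[OF bil]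
          bilinear_rmul[OF bil] inner_simps algebra_simps)
  define v where "v = (1/2) *\<^sub>R (\<Sum>b\<in>Basis. f b *\<^sub>R b)"
  have v: "\<forall>z. 2 * (v \<bullet> z) = f z"
    unfolding v_def inner_scaleR_left inner_represents_linear[OF \<open>linear f\<close>] by simp
  have "(THE w. \<forall>z. 2 * (w \<bullet> z) = f z) = v"
  proof (rule the_equality)
    fix w assume w: "\<forall>z. 2 * (w \<bullet> z) = f z"
    show "w = v"
    proof (rule euclidean_eqI)
      fix b :: 'a
      have "2 * (w \<bullet> b) = 2 * (v \<bullet> b)"
        using v w by (simp del: mult_cancel_left)
      then show "w \<bullet> b = v \<bullet> b" by simp
    qed
  qed (rule v)
  then have "levi_civita br x y = v"
    by (simp add: levi_civita_def f_def)
  then show ?thesis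
    using v by (simp add: f_def)
qed

lemma form_endo:
  assumes "two_form \<omega>"
  shows "linear (form_endo \<omega>)" and "\<omega> x y = form_endo \<omega> x \<bullet> y"
proof -
  have bil: "bilinear \<omega>"
    using assms by (simp add: two_form_def)
  define T where "T x = (\<Sum>b\<in>Basis. \<omega> x b *\<^sub>R b)" for x
  have T: "\<omega> x y = T x \<bullet> y" for x y
    unfolding T_def using bil by (simp add: inner_represents_linear bilinear_def)
  have lin: "linear T"
    by (rule linearI)
       (simp_all add: T_def bilinear_ladd[OF bil] bilinear_lmul[OF bil] scaleR_add_left
          sum.distrib scaleR_sum_right)
  have "form_endo \<omega> = T"
    unfolding form_endo_def
  proof (rule the_equality)
    fix S assume "linear S \<and> (\<forall>x y. \<omega> x y = S x \<bullet> y)"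
    then have "S x \<bullet> y = T x \<bullet> y" for x y
      using T[of x y] by simp
    then show "S = T"
      by (metis euclidean_eqI ext)
  qed (simp add: lin T)
  then show "linear (form_endo \<omega>)" and "\<omega> x y = form_endo \<omega> x \<bullet> y"
    using lin T by simp_all
qed

end

theory Submission
  imports Defs
begin

text \<open>
  Write \<open>\<nabla>\<close> for the Levi-Civita connection, \<open>T\<close> for the endomorphism of \<open>\<omega>\<close> and \<open>\<xi>\<close> for the
  vector dual to \<open>\<theta>\<close>. If \<open>\<omega>\<close> is closed, the CKY equation becomes
  \<open>(\<nabla>\<^sub>x T) y = \<langle>x,y\<rangle> \<xi> - \<theta>(y) x\<close>. For central \<open>z, v\<close> one has \<open>\<nabla>\<^sub>z v = 0\<close>, hence
  \<open>\<nabla>\<^sub>z (T v) = \<langle>z,v\<rangle> \<xi> - \<theta>(v) z\<close>; pairing with a third central vector shows that \<open>\<xi>\<close> is orthogonal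
  to the center once the center has dimension at least two. For orthonormal central \<open>z, z'\<close> the
  vectors \<open>z, z', \<xi>, T z, T z'\<close> are then linearly independent and orthogonal to \<open>T \<xi>\<close>, so in
  dimension five \<open>T \<xi> = 0\<close>. With \<open>t = \<nabla>\<^sub>z \<xi>\<close> this yields \<open>T t = |\<xi>|\<^sup>2 z\<close> and
  \<open>T (\<nabla>\<^sub>t \<xi>) = |\<xi>|\<^sup>2 t\<close>. Pairing the latter with \<open>t\<close> gives \<open>|\<xi>|\<^sup>2 |t|\<^sup>2 = - |\<xi>|\<^sup>2 |t|\<^sup>2\<close>, so \<open>t = 0\<close>,
  which contradicts \<open>T t \<noteq> 0\<close>.
\<close>

lemma lie_bracket_skew:
  assumes "lie_bracket br"
  shows "br x y = - br y x"
proof -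
  have bil: "bilinear br" and alt: "\<And>x. br x x = 0"
    using assms by (auto simp: lie_bracket_def)
  have "br (x + y) (x + y) = br x y + br y x"
    unfolding bilinear_ladd[OF bil] bilinear_radd[OF bil] by (simp add: alt)
  then show ?thesis
    by (simp add: alt eq_neg_iff_add_eq_0)
qed

lemma levi_civita_skew:
  assumes "lie_bracket br"
  shows "levi_civita br x y \<bullet> z = - (y \<bullet> levi_civita br x z)"
  using levi_civita_koszul[OF assms, of x y z] levi_civita_koszul[OF assms, of x z y]
    lie_bracket_skew[OF assms, of y z] lie_bracket_skew[OF assms, of z x]
    lie_bracket_skew[OF assms, of x y]
  by (simp add: inner_commute)

lemma levi_civita_torsion_free:
  assumes "lie_bracket br"
  shows "levi_civita br x y - levi_civita br y x = br x y"
proof (rule vector_eq_rdot[THEN iffD1], rule allI)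
  fix w
  show "(levi_civita br x y - levi_civita br y x) \<bullet> w = br x y \<bullet> w"
    using levi_civita_koszul[OF assms, of x y w] levi_civita_koszul[OF assms, of y x w]
      lie_bracket_skew[OF assms, of y w] lie_bracket_skew[OF assms, of w x]
      lie_bracket_skew[OF assms, of x y]
    by (simp add: inner_diff_left)
qed

lemma subspace_lie_center:
  assumes "lie_bracket br"
  shows "subspace (lie_center br)"
proof -
  have bil: "bilinear br"
    using assms by (simp add: lie_bracket_def)
  show ?thesis
    by (simp add: subspace_def lie_center_def bilinear_lzero[OF bil] bilinear_ladd[OF bil]
        bilinear_lmul[OF bil])
qed

lemma levi_civita_center_commute:
  assumes "lie_bracket br" "z \<in> lie_center br"
  shows "levi_civita br x z = levi_civita br z x"
  using levi_civita_torsion_free[OF assms(1), of z x] assms(2) by (simp add: lie_center_def)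

text \<open>Every bracket in the Koszul formula for \<open>levi_civita br z v\<close> has a central
  argument, so the right-hand side vanishes.\<close>

lemma levi_civita_center_center:
  assumes "lie_bracket br" "z \<in> lie_center br" "v \<in> lie_center br"
  shows "levi_civita br z v = 0"
proof -
  have "levi_civita br z v \<bullet> w = 0" for w
    using levi_civita_koszul[OF assms(1), of z v w] lie_bracket_skew[OF assms(1), of w z] assms(2,3)
    by (simp add: lie_center_def)
  then show ?thesis
    by (metis inner_eq_zero_iff)
qed

lemma form_endo_skew:
  assumes "two_form \<omega>"
  shows "form_endo \<omega> x \<bullet> y = - (x \<bullet> form_endo \<omega> y)"
proof -
  have bil: "bilinear \<omega>" and alt: "\<And>x. \<omega> x x = 0"
    using assms by (auto simp: two_form_def)
  have "\<omega> (x + y) (x + y) = \<omega> x y + \<omega> y x"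
    unfolding bilinear_ladd[OF bil] bilinear_radd[OF bil] by (simp add: alt)
  then show ?thesis
    by (simp add: alt form_endo(2)[OF assms] inner_commute)
qed

text \<open>The covariant derivative of an endomorphism is its commutator with
  \<open>levi_civita br x\<close>, and the commutator of two skew maps is skew.\<close>

lemma cov_deriv_form_endo_skew:
  assumes "lie_bracket br" "two_form \<omega>"
  shows "cov_deriv br x (form_endo \<omega>) y \<bullet> w = - (cov_deriv br x (form_endo \<omega>) w \<bullet> y)"
  using levi_civita_skew[OF assms(1), of x "form_endo \<omega> y" w]
    levi_civita_skew[OF assms(1), of x "form_endo \<omega> w" y]
    form_endo_skew[OF assms(2), of "levi_civita br x y" w]
    form_endo_skew[OF assms(2), of "levi_civita br x w" y]
  by (simp add: cov_deriv_def inner_diff_left inner_diff_right inner_commute)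

text \<open>Zero torsion replaces each bracket by a difference of covariant derivatives. Skewness of
  both maps then matches the resulting terms with those of the cyclic sum.\<close>

lemma ext_deriv_eq_cyclic_cov_deriv:
  assumes "lie_bracket br" "two_form \<omega>"
  shows "ext_deriv br \<omega> x y w =
    cov_deriv br x (form_endo \<omega>) y \<bullet> w + cov_deriv br y (form_endo \<omega>) w \<bullet> x
    + cov_deriv br w (form_endo \<omega>) x \<bullet> y"
proof -
  define T where "T = form_endo \<omega>"
  define D where "D = levi_civita br"
  have T: "linear T" "\<And>x y. \<omega> x y = T x \<bullet> y"
    using form_endo[OF assms(2)] by (auto simp: T_def)
  have skew: "D a (T b) \<bullet> c = T (D a c) \<bullet> b" for a b c
    using levi_civita_skew[OF assms(1), of a "T b" c] form_endo_skew[OF assms(2), of "D a c" b]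
    by (simp add: D_def T_def inner_commute)
  have torsion: "T (br a b) \<bullet> c = T (D a b) \<bullet> c - T (D b a) \<bullet> c" for a b c
    using levi_civita_torsion_free[OF assms(1), of a b]
    by (metis D_def T(1) inner_diff_left linear_diff)
  show ?thesis
    unfolding ext_deriv_def cov_deriv_def T_def[symmetric] D_def[symmetric]
    by (simp add: T(2) torsion inner_diff_left skew)
qed

text \<open>Skewness and the CKY equation turn each of the other two terms of the cyclic sum into
  \<open>N x y w\<close> plus terms in \<open>\<theta>\<close>. Since closedness makes the sum
  vanish, \<open>3 * N x y w\<close> is determined by \<open>\<theta>\<close>.\<close>

lemma closed_cky_cov_deriv:
  assumes "lie_bracket br" "two_form \<omega>" "cky_equation br \<omega> \<theta>"
    and closed: "\<And>x y w. ext_deriv br \<omega> x y w = 0"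
  shows "cov_deriv br x (form_endo \<omega>) y \<bullet> w = (x \<bullet> y) * \<theta> w - (x \<bullet> w) * \<theta> y"
proof -
  define N where "N a b c = cov_deriv br a (form_endo \<omega>) b \<bullet> c" for a b c
  have cky: "N a b c + N b a c = 2 * (a \<bullet> b) * \<theta> c - (b \<bullet> c) * \<theta> a - (a \<bullet> c) * \<theta> b" for a b c
    using assms(3) by (simp add: cky_equation_def N_def)
  have skew: "N a b c = - N a c b" for a b c
    unfolding N_def by (rule cov_deriv_form_endo_skew[OF assms(1,2)])
  have "N x y w + N y w x + N w x y = 0"
    using closed[of x y w] by (simp add: ext_deriv_eq_cyclic_cov_deriv[OF assms(1,2)] N_def)
  then have "N x y w = (x \<bullet> y) * \<theta> w - (x \<bullet> w) * \<theta> y"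
    using cky[of x y w] cky[of w x y] skew[of y w x] skew[of x w y]
    by (simp add: inner_commute)
  then show ?thesis
    by (simp add: N_def)
qed

lemma orthonormal_pair_in_subspace:
  fixes S :: "'a::euclidean_space set"
  assumes "subspace S" "dim S > 1"
  obtains u v where "u \<in> S" "v \<in> S" "u \<bullet> u = 1" "v \<bullet> v = 1" "u \<bullet> v = 0"
proof -
  obtain B where B: "B \<subseteq> S" "pairwise orthogonal B" "\<And>x. x \<in> B \<Longrightarrow> norm x = 1"
      "card B = dim S"
    using orthonormal_basis_subspace[OF assms(1)] by metis
  with assms(2) obtain u v where "u \<in> B" "v \<in> B" "u \<noteq> v"
    by (metis card_le_Suc0_iff_eq card.infinite less_one not_le not_less_iff_gr_or_eq One_nat_def
        less_imp_le zero_less_one)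
  then show thesis
    using B by (intro that[of u v]) (auto simp: pairwise_def orthogonal_def dot_square_norm)
qed

text \<open>The orthogonal complement of \<open>S\<close> is that of its span. Each independence
  step below thus reduces to exhibiting a separating vector \<open>a\<close>.\<close>

lemma notin_span_if_orthogonal:
  assumes "\<And>s. s \<in> S \<Longrightarrow> a \<bullet> s = 0" "a \<bullet> x \<noteq> 0"
  shows "x \<notin> span S"
  using orthogonal_to_span[of x S a] assms by (auto simp: orthogonal_def)

lemma independent_card_insert:
  fixes S :: "'a::euclidean_space set"
  assumes "independent S" "x \<notin> span S"
  shows "independent (insert x S) \<and> card (insert x S) = Suc (card S)"
  using assms span_base[of x S] independent_bound[OF assms(1)]
  by (auto simp: independent_insert card_insert_if)

theorem proposition6p3:
  fixes br :: "'a::euclidean_space \<Rightarrow> 'a \<Rightarrow> 'a"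
    and \<omega> :: "'a \<Rightarrow> 'a \<Rightarrow> real"
  assumes "DIM('a) = 5"
    and "lie_bracket br"
    and "dim (lie_center br) > 1"
    and "strict_cky br \<omega>"
  shows "ext_deriv br \<omega> \<noteq> (\<lambda>_ _ _. 0)"
proof
  assume closed: "ext_deriv br \<omega> = (\<lambda>_ _ _. 0)"
  obtain \<theta> where form: "two_form \<omega>" and \<theta>: "linear \<theta>" "\<theta> \<noteq> (\<lambda>_. 0)" "cky_equation br \<omega> \<theta>"
    using assms(4) by (auto simp: strict_cky_def)
  define \<xi> where "\<xi> = (\<Sum>b\<in>Basis. \<theta> b *\<^sub>R b)"
  have \<xi>: "\<theta> x = \<xi> \<bullet> x" for x
    by (simp add: \<xi>_def inner_represents_linear[OF \<theta>(1)])
  have \<xi>0: "\<xi> \<noteq> 0"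
    using \<theta>(2) \<xi> by (metis ext inner_zero_left)
  define T where "T = form_endo \<omega>"
  define D where "D = levi_civita br"
  note T_skew = form_endo_skew[OF form, folded T_def]
  note D_skew = levi_civita_skew[OF assms(2), folded D_def]
  note D_commute = levi_civita_center_commute[OF assms(2), folded D_def]
  note D_center = levi_civita_center_center[OF assms(2), folded D_def]
  have main: "D x (T y) - T (D x y) = (x \<bullet> y) *\<^sub>R \<xi> - (\<xi> \<bullet> y) *\<^sub>R x" for x y
  proof (rule vector_eq_rdot[THEN iffD1], rule allI)
    fix w
    show "(D x (T y) - T (D x y)) \<bullet> w = ((x \<bullet> y) *\<^sub>R \<xi> - (\<xi> \<bullet> y) *\<^sub>R x) \<bullet> w"
      using closed_cky_cov_deriv[OF assms(2) form \<theta>(3), of x y w] closed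
      by (simp add: cov_deriv_def D_def T_def \<xi> inner_diff_left)
  qed
  have T0: "T 0 = 0"
    using form_endo(1)[OF form] by (simp add: T_def linear_0)
  obtain z z' where center: "z \<in> lie_center br" "z' \<in> lie_center br"
    and orth: "z \<bullet> z = 1" "z' \<bullet> z' = 1" "z \<bullet> z' = 0"
    using orthonormal_pair_in_subspace[OF subspace_lie_center[OF assms(2)] assms(3)] by metis
  have DT: "D a (T b) = (a \<bullet> b) *\<^sub>R \<xi> - (\<xi> \<bullet> b) *\<^sub>R a"
    if "a \<in> lie_center br" "b \<in> lie_center br" for a b
    using main[of a b] D_center[OF that] by (simp add: T0)
  have D_perp: "D a x \<bullet> b = 0" if "a \<in> lie_center br" "b \<in> lie_center br" for a b x
    using D_skew[of a x b] D_center[OF that] by simp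
  \<comment> \<open>Here two orthogonal central directions matter: \<open>D z (T z)\<close> is
    \<open>\<xi>\<close> minus a multiple of \<open>z\<close>, so pairing it with \<open>z'\<close>
    isolates \<open>\<xi> \<bullet> z'\<close>.\<close>
  have "\<xi> \<bullet> z' = 0"
    using D_perp[OF center, of "T z"] DT[OF center(1,1)] orth by (simp add: inner_diff_left)
  moreover have "\<xi> \<bullet> z = 0"
    using D_perp[OF center(2,1), of "T z'"] DT[OF center(2,2)] orth
    by (simp add: inner_diff_right inner_commute)
  ultimately have \<xi>_perp: "\<xi> \<bullet> z = 0" "\<xi> \<bullet> z' = 0" "z \<bullet> \<xi> = 0" "z' \<bullet> \<xi> = 0"
    by (simp_all add: inner_commute)
  have DT_zz: "D z (T z) = \<xi>" "D z (T z') = 0" "D z' (T z) = 0" "D z' (T z') = \<xi>"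
    using DT[OF center(1,1)] DT[OF center(1,2)] DT[OF center(2,1)] DT[OF center(2,2)] \<xi>_perp orth
    by (simp_all add: inner_commute)
  have D_self: "D a x \<bullet> x = 0" for a x
    using D_skew[of a x x] by (simp add: inner_commute)
  have \<xi>_perp_T: "\<xi> \<bullet> T z = 0" "\<xi> \<bullet> T z' = 0"
    using D_self[of z "T z"] D_self[of z' "T z'"] by (simp_all add: DT_zz)
  have T_self: "T x \<bullet> x = 0" for x
    using T_skew[of x x] by (simp add: inner_commute)
  have "T \<xi> = D z (T (T z))" "T \<xi> = D z' (T (T z'))"
    using main[of z "T z"] main[of z' "T z'"] \<xi>_perp_T T_self[of z] T_self[of z']
    by (simp_all add: DT_zz inner_commute)
  \<comment> \<open>The pairing is crossed: against \<open>T z\<close> the expression through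
    \<open>z'\<close> is used, because skewness of \<open>D z'\<close> moves it onto
    \<open>T z\<close> and \<open>D z' (T z) = 0\<close>; likewise with the roles exchanged.\<close>
  then have T\<xi>_perp_T: "T \<xi> \<bullet> T z = 0" "T \<xi> \<bullet> T z' = 0"
    using D_skew[of z' "T (T z')" "T z"] D_skew[of z "T (T z)" "T z'"] by (simp_all add: DT_zz)
  have T\<xi>: "T \<xi> = 0"
  proof (rule ccontr)
    assume nz: "T \<xi> \<noteq> 0"
    have perp: "T \<xi> \<bullet> x = 0" if "x \<in> {T z, T z', \<xi>, z, z'}" for x
      using that T\<xi>_perp_T T_self[of \<xi>] T_skew[of \<xi> z] T_skew[of \<xi> z'] \<xi>_perp_T by auto
    have dual: "D a \<xi> \<bullet> T b = - ((D a (T b)) \<bullet> \<xi>)" for a b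
      using D_skew[of a \<xi> "T b"] by (simp add: inner_commute)
    have "z \<notin> span {z'}"
      using orth by (intro notin_span_if_orthogonal[of _ z]) auto
    moreover have "independent {z'}"
      using orth by (auto simp: dependent_single)
    ultimately have ind2: "independent {z, z'} \<and> card {z, z'} = 2"
      using independent_card_insert[of "{z'}" z] by simp
    have "\<xi> \<notin> span {z, z'}"
      using \<xi>0 \<xi>_perp by (intro notin_span_if_orthogonal[of _ \<xi>]) auto
    then have ind3: "independent {\<xi>, z, z'} \<and> card {\<xi>, z, z'} = 3"
      using independent_card_insert[of "{z, z'}" \<xi>] ind2 by simp
    \<comment> \<open>The separating vector \<open>D z' \<xi>\<close> is orthogonal to the center by
      \<open>D_perp\<close> and to \<open>\<xi>\<close> by \<open>D_self\<close>, while
      \<open>dual\<close> gives its product with \<open>T z'\<close> as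
      \<open>- (\<xi> \<bullet> \<xi>)\<close>.\<close>
    have "T z' \<notin> span {\<xi>, z, z'}"
      using \<xi>0 D_perp center D_self[of z' \<xi>]
      by (intro notin_span_if_orthogonal[of _ "D z' \<xi>"]) (auto simp: dual DT_zz)
    then have ind4: "independent {T z', \<xi>, z, z'} \<and> card {T z', \<xi>, z, z'} = 4"
      using independent_card_insert[of "{\<xi>, z, z'}" "T z'"] ind3 by simp
    \<comment> \<open>The witness \<open>D z \<xi>\<close> is moreover orthogonal to
      \<open>T z'\<close>, since \<open>D z (T z') = 0\<close>.\<close>
    have "T z \<notin> span {T z', \<xi>, z, z'}"
      using \<xi>0 D_perp center D_self[of z \<xi>]
      by (intro notin_span_if_orthogonal[of _ "D z \<xi>"]) (auto simp: dual DT_zz)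
    then have ind5: "independent {T z, T z', \<xi>, z, z'} \<and> card {T z, T z', \<xi>, z, z'} = 5"
      using independent_card_insert[of "{T z', \<xi>, z, z'}" "T z"] ind4 by simp
    have "T \<xi> \<notin> span {T z, T z', \<xi>, z, z'}"
      using nz by (intro notin_span_if_orthogonal[of _ "T \<xi>"] perp) auto
    then have "independent {T \<xi>, T z, T z', \<xi>, z, z'} \<and> card {T \<xi>, T z, T z', \<xi>, z, z'} = 6"
      using independent_card_insert[of "{T z, T z', \<xi>, z, z'}" "T \<xi>"] ind5 by simp
    then show False
      using independent_bound[of "{T \<xi>, T z, T z', \<xi>, z, z'}"] assms(1) by simp
  qed
  have D0: "D x 0 = 0" for x
    using D_skew[of x 0 "D x 0"] by simp
  define t where "t = D z \<xi>"
  have Tt: "T t = (\<xi> \<bullet> \<xi>) *\<^sub>R z"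
    using main[of z \<xi>] by (simp add: T\<xi> D0 \<xi>_perp t_def)
  have t_perp: "t \<bullet> \<xi> = 0"
    using D_self by (simp add: t_def)
  have "T (D t \<xi>) = (\<xi> \<bullet> \<xi>) *\<^sub>R t"
    using main[of t \<xi>] by (simp add: T\<xi> D0 t_perp)
  then have "(\<xi> \<bullet> \<xi>) * (t \<bullet> t) = T (D t \<xi>) \<bullet> t"
    by simp
  also have "\<dots> = - ((\<xi> \<bullet> \<xi>) * (D t \<xi> \<bullet> z))"
    by (simp add: T_skew Tt)
  \<comment> \<open>Centrality of \<open>z\<close> allows \<open>D t z\<close> to be replaced by
    \<open>D z t\<close>, which brings back the derivative defining \<open>t\<close>.\<close>
  also have "D t \<xi> \<bullet> z = - (\<xi> \<bullet> D z t)"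
    by (simp add: D_skew[of t] D_commute[OF center(1)])
  also have "\<xi> \<bullet> D z t = - (t \<bullet> t)"
    using D_skew[of z \<xi> t] by (simp add: t_def)
  finally have "t = 0"
    using \<xi>0 by simp
  then show False
    using Tt T0 \<xi>0 orth by auto
qed

end
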